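(* The prefixes $12$ and $21$ may be exchanged. That is, for every $k\ge 2$, every ordering $\tau=\tau_3\ldots\tau_k$ of $\{3,\dots,k\}$, and every $n$, $\mathcal{I}_n(12\tau_3\ldots\tau_k)=\mathcal{I}_n(21\tau_3\ldots\tau_k)$.
   Context: A permutation $\pi=\pi_1\ldots\pi_n\in\mathcal{S}_n$ avoids $\sigma\in\mathcal{S}_k$ if there is no subsequence $\pi_{i_1}\ldots\pi_{i_k}$, $i_1<\cdots<i_k$, whose order-preserving relabelling by $1,\dots,k$ is $\sigma$. $\mathcal{I}_n(\sigma)$ denotes the number of involutions in $\mathcal{S}_n$ (permutations whose square is the identity) which avoid $\sigma$. Write $\sigma\sim_{\mathcal I}\sigma'$ if $\mathcal{I}_n(\sigma)=\mathcal{I}_n(\sigma')$ for every $n$. For $\alpha,\beta\in\mathcal{S}_j$, the prefixes $\alpha$ and $\beta$ may be exchanged if for every $k\ge j$ and every ordering $\tau=\tau_{j+1}\ldots\tau_k$ of $\{j+1,\dots,k\}$, $\alpha_1\ldots\alpha_j\tau_{j+1}\ldots\tau_k\sim_{\mathcal I}\beta_1\ldots\beta_j\tau_{j+1}\ldots\tau_k$. *)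

theory Defs
  imports
    "HOL-Library.Sublist"
    "HOL-Combinatorics.Permutations"
    "HOL-Combinatorics.Multiset_Permutations"
begin

text \<open>
  An element of the symmetric group on \<open>{1..n}\<close> is a function \<open>\<pi> permutes {1..n}\<close>. Patterns and
  prefixes are written as words in one-line notation, i.e. as elements of
  \<open>permutations_of_set {1..k}\<close>, so that appending \<open>\<tau>\<close> to a prefix is list append.
\<close>

definition one_line :: "nat \<Rightarrow> (nat \<Rightarrow> nat) \<Rightarrow> nat list" where
  "one_line n \<pi> = map \<pi> [1..<Suc n]"

text \<open>
  \<open>subseq\<close> allows gaps. If \<open>\<sigma>\<close> is a permutation word of \<open>{1..k}\<close>, then an \<open>f\<close> as below is
  an increasing bijection from the letters of \<open>u\<close> onto \<open>{1..k}\<close>, hence on these letters it is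
  the unique order-preserving relabelling by \<open>1, \<dots>, k\<close>.
\<close>

definition word_contains :: "nat list \<Rightarrow> nat list \<Rightarrow> bool" where
  "word_contains w \<sigma> \<longleftrightarrow>
     (\<exists>u. subseq u w \<and> (\<exists>f. strict_mono_on (set u) f \<and> map f u = \<sigma>))"

definition avoids :: "nat \<Rightarrow> (nat \<Rightarrow> nat) \<Rightarrow> nat list \<Rightarrow> bool" where
  "avoids n \<pi> \<sigma> \<longleftrightarrow> \<not> word_contains (one_line n \<pi>) \<sigma>"

definition inv_count :: "nat \<Rightarrow> nat list \<Rightarrow> nat" where
  "inv_count n \<sigma> = card {\<pi>. \<pi> permutes {1..n} \<and> \<pi> \<circ> \<pi> = id \<and> avoids n \<pi> \<sigma>}"

definition inv_equiv :: "nat list \<Rightarrow> nat list \<Rightarrow> bool" (infix "\<sim>\<^sub>I" 50) where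
  "\<sigma> \<sim>\<^sub>I \<sigma>' \<longleftrightarrow> (\<forall>n. inv_count n \<sigma> = inv_count n \<sigma>')"

definition prefixes_exchangeable :: "nat \<Rightarrow> nat list \<Rightarrow> nat list \<Rightarrow> bool" where
  "prefixes_exchangeable j \<alpha> \<beta> \<longleftrightarrow>
     \<alpha> \<in> permutations_of_set {1..j} \<and> \<beta> \<in> permutations_of_set {1..j} \<and>
     (\<forall>k\<ge>j. \<forall>\<tau>\<in>permutations_of_set {j+1..k}. \<alpha> @ \<tau> \<sim>\<^sub>I \<beta> @ \<tau>)"

end

theory Submission
  imports Defs
begin

text \<open>
  Let \<open>P\<close> be the graph of a permutation and \<open>L\<close> the set of cells that have a copy of \<open>\<tau>\<close> in \<open>P\<close>
  strictly to the north-east, or whose transposes have one in \<open>P\<inverse>\<close>. \<open>L\<close> is closed downwards and depends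
  only on the points of \<open>P\<close> outside \<open>L\<close>, and for an involution it is symmetric. An involution
  contains \<open>12\<tau>\<close> (or \<open>21\<tau>\<close>) if and only if it has an ascending (or descending) pair of points
  whose north-east corner lies in \<open>L\<close>. Among the permutations that agree outside \<open>L\<close> exactly one
  has no ascending such pair, since exchanging the two values keeps both points in \<open>L\<close>, and
  likewise for descending pairs. Uniqueness makes this permutation an involution when \<open>L\<close> and
  the points outside \<open>L\<close> are symmetric. So every class of involutions that agree outside \<open>L\<close>
  contains exactly one avoider of either kind.
\<close>

section \<open>Pattern containment in terms of points\<close>

definition occurrence :: "nat list \<Rightarrow> (nat \<times> nat) set \<Rightarrow> (nat \<times> nat) list \<Rightarrow> bool" where
  "occurrence \<sigma> P ps \<longleftrightarrow> set ps \<subseteq> P \<and> sorted_wrt (\<lambda>p q. fst p < fst q) ps \<and>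
     (\<exists>f. strict_mono_on (set (map snd ps)) f \<and> map f (map snd ps) = \<sigma>)"

definition graph_on :: "nat \<Rightarrow> (nat \<Rightarrow> nat) \<Rightarrow> (nat \<times> nat) set" where
  "graph_on n \<pi> = (\<lambda>i. (i, \<pi> i)) ` {1..n}"

definition dominated :: "nat list \<Rightarrow> (nat \<times> nat) set \<Rightarrow> (nat \<times> nat) set" where
  "dominated \<tau> P = {(i, j). \<exists>ps. occurrence \<tau> P ps \<and> (\<forall>(a, b)\<in>set ps. i < a \<and> j < b)}"

text \<open>The second part makes the construction commute with transposition, so that the region is
  symmetric whenever \<open>P\<close> is.\<close>

definition region :: "nat list \<Rightarrow> (nat \<times> nat) set \<Rightarrow> (nat \<times> nat) set" where
  "region \<tau> P = dominated \<tau> P \<union> (dominated \<tau> (P\<inverse>))\<inverse>"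

text \<open>The cell \<open>(j, max a b)\<close> is the north-east corner of the two points: what
  lies strictly beyond it lies strictly beyond both. Taking \<open>r\<close> as \<open><\<close> or
  \<open>>\<close> lets one notion serve both prefixes.\<close>

definition has_pair :: "(nat \<Rightarrow> nat \<Rightarrow> bool) \<Rightarrow> (nat \<times> nat) set \<Rightarrow> (nat \<times> nat) set \<Rightarrow> bool" where
  "has_pair r P L \<longleftrightarrow>
     (\<exists>i a j b. (i, a) \<in> P \<and> (j, b) \<in> P \<and> i < j \<and> r a b \<and> (j, max a b) \<in> L)"

lemma mem_graph_on [simp]: "(i, a) \<in> graph_on n \<pi> \<longleftrightarrow> i \<in> {1..n} \<and> a = \<pi> i"
  by (auto simp: graph_on_def)

text \<open>A word forgets positions; the index set that selects \<open>u\<close> recovers them when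
  applied to \<open>[1..<Suc n]\<close>. Conversely, strictly increasing positions within
  \<open>{1..n}\<close> form a subsequence of that list.\<close>

lemma word_contains_iff_occurrence:
  "word_contains (one_line n \<pi>) \<sigma> \<longleftrightarrow> (\<exists>ps. occurrence \<sigma> (graph_on n \<pi>) ps)"
proof
  assume "word_contains (one_line n \<pi>) \<sigma>"
  then obtain u f where u: "subseq u (map \<pi> [1..<Suc n])"
    and f: "strict_mono_on (set u) f" "map f u = \<sigma>"
    unfolding word_contains_def one_line_def by blast
  from u obtain N where "u = map \<pi> (nths [1..<Suc n] N)"
    by (auto simp: subseq_conv_nths nths_map)
  moreover define g where "g = nths [1..<Suc n] N"
  moreover define ps where "ps = map (\<lambda>i. (i, \<pi> i)) g"
  ultimately have u_eq: "u = map snd ps"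
    by (simp add: comp_def)
  have g: "sorted_wrt (<) g" "set g \<subseteq> {1..n}"
    unfolding g_def strict_sorted_iff
    by (auto simp del: upt_Suc intro: sorted_nths distinct_nthsI dest: in_set_nthsD)
  have "set ps \<subseteq> graph_on n \<pi>" "sorted_wrt (\<lambda>p q. fst p < fst q) ps"
    using g by (auto simp: ps_def sorted_wrt_map)
  then show "\<exists>ps. occurrence \<sigma> (graph_on n \<pi>) ps"
    using f unfolding occurrence_def u_eq by blast
next
  assume "\<exists>ps. occurrence \<sigma> (graph_on n \<pi>) ps"
  then obtain ps f where ps: "set ps \<subseteq> graph_on n \<pi>" "sorted_wrt (\<lambda>p q. fst p < fst q) ps"
    and f: "strict_mono_on (set (map snd ps)) f" "map f (map snd ps) = \<sigma>"
    unfolding occurrence_def by blast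
  have eq: "map snd ps = map \<pi> (map fst ps)"
    using ps(1) by (auto simp: graph_on_def)
  have "sorted_wrt (<) (map fst ps)"
    using ps(2) by (simp add: sorted_wrt_map)
  moreover have "set (map fst ps) \<subseteq> set [1..<Suc n]"
    using ps(1) by (auto simp: graph_on_def)
  ultimately have "subseq (map fst ps) [1..<Suc n]"
    by (intro sorted_subset_imp_subseq) (auto simp: strict_sorted_iff simp del: upt_Suc)
  then have "subseq (map snd ps) (one_line n \<pi>)"
    unfolding one_line_def eq by (rule subseq_map)
  then show "word_contains (one_line n \<pi>) \<sigma>"
    using f unfolding word_contains_def by blast
qed

text \<open>The letters of \<open>\<tau>\<close> exceed \<open>2\<close>, so in a copy of the whole
  pattern all later points lie to the right of and above the first two, hence beyond their corner.
  Conversely, a pair ordered by \<open>r\<close> can be prepended to any copy of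
  \<open>\<tau>\<close> beyond its corner.\<close>

lemma occurrence_prefix_iff_has_pair:
  assumes xy: "(x, y) = (1, 2) \<and> r = (<) \<or> (x, y) = (2, 1) \<and> r = (>)"
    and \<tau>: "\<forall>t\<in>set \<tau>. 2 < t"
  shows "(\<exists>ps. occurrence ([x, y] @ \<tau>) P ps) \<longleftrightarrow> has_pair r P (dominated \<tau> P)"
proof
  assume "\<exists>ps. occurrence ([x, y] @ \<tau>) P ps"
  then obtain ps f where ps: "set ps \<subseteq> P" "sorted_wrt (\<lambda>p q. fst p < fst q) ps"
    and f: "strict_mono_on (set (map snd ps)) f" "map f (map snd ps) = [x, y] @ \<tau>"
    unfolding occurrence_def by blast
  \<comment> \<open>The rule \<open>remdups_adj.cases\<close> serves only to split lists into empty,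
    singleton and longer ones.\<close>
  from f(2) obtain i a j b qs where ps_eq: "ps = (i, a) # (j, b) # qs"
    by (cases ps rule: remdups_adj.cases) auto
  have f': "f a = x" "f b = y" "map f (map snd qs) = \<tau>"
    using f(2) by (auto simp: ps_eq)
  have less: "c < d \<longleftrightarrow> f c < f d" if "c \<in> set (map snd ps)" "d \<in> set (map snd ps)" for c d
    using strict_mono_on_less[OF f(1) that] by simp
  have "r a b"
    using xy f'(1,2) less[of a b] less[of b a] by (auto simp: ps_eq)
  have above: "max a b < d" if "(c, d) \<in> set qs" for c d
  proof -
    have "f d \<in> set \<tau>"
      using that f'(3) by force
    then have "f a < f d" "f b < f d"
      using \<tau> f' xy by auto
    moreover have "d \<in> set (map snd ps)"
      using that by (force simp: ps_eq)
    ultimately show ?thesis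
      using less[of a d] less[of b d] by (auto simp: ps_eq)
  qed
  have "occurrence \<tau> P qs"
    unfolding occurrence_def using ps f(1) f'(3)
    by (auto simp: ps_eq intro!: exI[of _ f] elim: monotone_on_subset)
  moreover have "\<forall>(c, d)\<in>set qs. j < c \<and> max a b < d"
    using ps(2) above by (auto simp: ps_eq)
  ultimately have "(j, max a b) \<in> dominated \<tau> P"
    unfolding dominated_def by blast
  then show "has_pair r P (dominated \<tau> P)"
    unfolding has_pair_def using ps \<open>r a b\<close> by (auto simp: ps_eq)
next
  assume "has_pair r P (dominated \<tau> P)"
  then obtain i a j b where ij: "(i, a) \<in> P" "(j, b) \<in> P" "i < j" "r a b"
    and "(j, max a b) \<in> dominated \<tau> P"
    unfolding has_pair_def by blast
  then obtain qs f where qs: "set qs \<subseteq> P" "sorted_wrt (\<lambda>p q. fst p < fst q) qs"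
    and f: "strict_mono_on (set (map snd qs)) f" "map f (map snd qs) = \<tau>"
    and dom: "\<forall>(c, d)\<in>set qs. j < c \<and> max a b < d"
    unfolding dominated_def occurrence_def by blast
  \<comment> \<open>The values in \<open>qs\<close> all exceed \<open>max a b\<close>, so the update
    does not disturb the relabelling of \<open>qs\<close>.\<close>
  define g where "g = f(a := x, b := y)"
  have "a \<noteq> b"
    using xy ij(4) by auto
  have g_eq: "g d = f d" if "d \<in> set (map snd qs)" for d
    using that dom by (auto simp: g_def)
  have f_gt: "2 < f d" if "d \<in> set (map snd qs)" for d
    using that f(2) \<tau> by (metis (no_types) image_eqI list.set_map)
  have "strict_mono_on (set (map snd ((i, a) # (j, b) # qs))) g"
  proof (rule strict_mono_onI)
    fix c d
    assume cd: "c \<in> set (map snd ((i, a) # (j, b) # qs))"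
      "d \<in> set (map snd ((i, a) # (j, b) # qs))" "c < d"
    have big: "a < e \<and> b < e" if "e \<in> set (map snd qs)" for e
      using that dom by auto
    consider "c \<in> set (map snd qs)" "d \<in> set (map snd qs)"
      | "c \<in> {a, b}" "d \<in> set (map snd qs)" | "c \<in> {a, b}" "d \<in> {a, b}"
      using cd big by fastforce
    then show "g c < g d"
    proof cases
      case 1
      then show ?thesis
        using f(1) cd(3) g_eq by (simp add: strict_mono_onD)
    next
      case 2
      then show ?thesis
        using f_gt[OF 2(2)] g_eq[OF 2(2)] xy by (auto simp: g_def)
    next
      case 3
      then show ?thesis
        using cd(3) xy ij(4) \<open>a \<noteq> b\<close> by (auto simp: g_def)
    qed
  qed
  moreover have "map g (map snd qs) = \<tau>"
    using f(2) g_eq by (metis map_cong)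
  then have "map g (map snd ((i, a) # (j, b) # qs)) = [x, y] @ \<tau>"
    using \<open>a \<noteq> b\<close> by (simp add: g_def)
  moreover have "sorted_wrt (\<lambda>p q. fst p < fst q) ((i, a) # (j, b) # qs)"
    using qs(2) dom ij(3) by fastforce
  ultimately have "occurrence ([x, y] @ \<tau>) P ((i, a) # (j, b) # qs)"
    unfolding occurrence_def using qs(1) ij(1,2) by (intro conjI exI[of _ g]) auto
  then show "\<exists>ps. occurrence ([x, y] @ \<tau>) P ps"
    by blast
qed

section \<open>The region and its dependence on the points outside it\<close>

lemma dominated_downward:
  assumes "(i, j) \<in> dominated \<tau> P" "i' \<le> i" "j' \<le> j"
  shows "(i', j') \<in> dominated \<tau> P"
proof -
  from assms(1) obtain ps where "occurrence \<tau> P ps" "\<forall>(a, b)\<in>set ps. i < a \<and> j < b"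
    unfolding dominated_def by blast
  moreover from this(2) assms(2,3) have "\<forall>(a, b)\<in>set ps. i' < a \<and> j' < b"
    by fastforce
  ultimately show ?thesis
    unfolding dominated_def by blast
qed

lemma region_downward:
  "(i, j) \<in> region \<tau> P \<Longrightarrow> i' \<le> i \<Longrightarrow> j' \<le> j \<Longrightarrow> (i', j') \<in> region \<tau> P"
  unfolding region_def by (auto intro: dominated_downward)

lemma region_converse: "region \<tau> (P\<inverse>) = (region \<tau> P)\<inverse>"
  by (auto simp: region_def)

text \<open>The copy that witnesses membership of a cell uses only points strictly north-east of
  that cell.\<close>

lemma dominated_transfer:
  assumes "(i, j) \<in> dominated \<tau> P"
    and "\<And>a b. (a, b) \<in> P \<Longrightarrow> i < a \<Longrightarrow> j < b \<Longrightarrow> (a, b) \<in> Q"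
  shows "(i, j) \<in> dominated \<tau> Q"
proof -
  from assms(1) obtain ps where ps: "occurrence \<tau> P ps" "\<forall>(a, b)\<in>set ps. i < a \<and> j < b"
    unfolding dominated_def by blast
  then have "set ps \<subseteq> Q"
    using assms(2) unfolding occurrence_def by fast
  then have "occurrence \<tau> Q ps"
    using ps(1) unfolding occurrence_def by blast
  then show ?thesis
    using ps(2) unfolding dominated_def by blast
qed

lemma region_transfer:
  assumes "(i, j) \<in> region \<tau> P"
    and "\<And>a b. (a, b) \<in> P \<Longrightarrow> i < a \<Longrightarrow> j < b \<Longrightarrow> (a, b) \<in> Q"
  shows "(i, j) \<in> region \<tau> Q"
  using assms(1) unfolding region_def
  by (auto intro: dominated_transfer[of _ _ _ P] dominated_transfer[of _ _ _ "P\<inverse>"] assms(2))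

text \<open>Beyond a cell outside \<open>region \<tau> P\<close> there is no cell of that region, so
  the points of \<open>Q\<close> there are points of \<open>P\<close>; this gives one inclusion. The
  other goes by induction from right to left: either some point of \<open>P\<close> in the region
  lies beyond the cell, and the induction hypothesis for it passes down to the cell, or all points
  of \<open>P\<close> beyond the cell are shared with \<open>Q\<close>. The bound on
  \<open>P\<close> makes \<open>n - i\<close> decrease.\<close>

lemma region_cong:
  assumes P: "P \<subseteq> {..n} \<times> {..n}"
    and eq: "P - region \<tau> P = Q - region \<tau> P"
  shows "region \<tau> Q = region \<tau> P"
proof (intro set_eqI iffI; clarify)
  fix i j
  assume "(i, j) \<in> region \<tau> Q"
  show "(i, j) \<in> region \<tau> P"
  proof (rule ccontr)
    assume not: "(i, j) \<notin> region \<tau> P"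
    have "(i, j) \<in> region \<tau> P"
    proof (rule region_transfer[OF \<open>(i, j) \<in> region \<tau> Q\<close>])
      fix a b
      assume "(a, b) \<in> Q" "i < a" "j < b"
      with not have "(a, b) \<notin> region \<tau> P"
        by (meson less_imp_le region_downward)
      with \<open>(a, b) \<in> Q\<close> eq show "(a, b) \<in> P"
        by blast
    qed
    with not show False ..
  qed
next
  fix i j
  assume "(i, j) \<in> region \<tau> P"
  then show "(i, j) \<in> region \<tau> Q"
  proof (induction "n - i" arbitrary: i j rule: less_induct)
    case less
    show ?case
    proof (cases "\<exists>a b. (a, b) \<in> P \<inter> region \<tau> P \<and> i < a \<and> j < b")
      case True
      then obtain a b where ab: "(a, b) \<in> P" "(a, b) \<in> region \<tau> P" "i < a" "j < b"
        by blast
      then have "n - a < n - i"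
        using P by auto
      then have "(a, b) \<in> region \<tau> Q"
        using less.hyps ab(2) by blast
      then show ?thesis
        using ab(3,4) by (meson less_imp_le region_downward)
    next
      case False
      then show ?thesis
        using region_transfer[OF less.prems] eq by blast
    qed
  qed
qed

section \<open>Behaviour of pairs under transposition\<close>

text \<open>Transposition turns ascending pairs into ascending ones and descending into descending,
  and it transposes the corner. So a corner in the transposed part of the region yields a pair with
  its corner in \<open>dominated \<tau> P\<close>.\<close>

lemma has_pair_region_iff_dominated:
  assumes r: "r = (<) \<or> r = (>)" and sym: "P\<inverse> = P"
  shows "has_pair r P (region \<tau> P) \<longleftrightarrow> has_pair r P (dominated \<tau> P)"
proof
  assume "has_pair r P (region \<tau> P)"
  then obtain i a j b where ij: "(i, a) \<in> P" "(j, b) \<in> P" "i < j" "r a b"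
    and L: "(j, max a b) \<in> dominated \<tau> P \<or> (max a b, j) \<in> dominated \<tau> P"
    unfolding has_pair_def region_def using sym by auto
  from ij sym have conv: "(a, i) \<in> P" "(b, j) \<in> P"
    by blast+
  from L show "has_pair r P (dominated \<tau> P)"
  proof
    assume "(j, max a b) \<in> dominated \<tau> P"
    then show ?thesis
      using ij unfolding has_pair_def by blast
  next
    assume L': "(max a b, j) \<in> dominated \<tau> P"
    from r show ?thesis
    proof
      assume "r = (<)"
      with ij L' conv show ?thesis
        unfolding has_pair_def by (intro exI[of _ a] exI[of _ i] exI[of _ b] exI[of _ j]) auto
    next
      \<comment> \<open>The transpose of a descending pair has its two points in the opposite
        horizontal order, so they trade roles.\<close>
      assume "r = (>)"
      with ij L' conv show ?thesis
        unfolding has_pair_def by (intro exI[of _ b] exI[of _ j] exI[of _ a] exI[of _ i]) auto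
    qed
  qed
next
  assume "has_pair r P (dominated \<tau> P)"
  then show "has_pair r P (region \<tau> P)"
    unfolding has_pair_def region_def by blast
qed

lemma has_pair_converse:
  assumes r: "r = (<) \<or> r = (>)"
    and "has_pair r P L"
  shows "has_pair r (P\<inverse>) (L\<inverse>)"
proof -
  from assms(2) obtain i a j b where ij: "(i, a) \<in> P" "(j, b) \<in> P" "i < j" "r a b"
    and L: "(j, max a b) \<in> L"
    unfolding has_pair_def by blast
  from r show ?thesis
  proof
    assume "r = (<)"
    with ij L show ?thesis
      unfolding has_pair_def by (intro exI[of _ a] exI[of _ i] exI[of _ b] exI[of _ j]) auto
  next
    assume "r = (>)"
    with ij L show ?thesis
      unfolding has_pair_def by (intro exI[of _ b] exI[of _ j] exI[of _ a] exI[of _ i]) auto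
  qed
qed

lemma graph_on_inv:
  assumes "\<pi> permutes {1..n}"
  shows "graph_on n (inv \<pi>) = (graph_on n \<pi>)\<inverse>"
proof -
  have "i \<in> {1..n} \<and> a = inv \<pi> i \<longleftrightarrow> a \<in> {1..n} \<and> i = \<pi> a" for i a
    using assms permutes_in_image[OF assms, of a] permutes_inverses[OF assms] by metis
  then show ?thesis
    by auto
qed

section \<open>Existence and uniqueness of the avoider in a class\<close>

text \<open>
  The largest position at which two candidates differ carries an ascent in one of them and a
  descent in the other, both with corner in \<open>L\<close>.
\<close>

lemma avoider_unique:
  assumes r: "r = (<) \<or> r = (>)"
    and \<pi>: "\<pi> permutes {1..n}" and \<sigma>: "\<sigma> permutes {1..n}"
    and eq: "graph_on n \<pi> - L = graph_on n \<sigma> - L"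
    and av: "\<not> has_pair r (graph_on n \<pi>) L" "\<not> has_pair r (graph_on n \<sigma>) L"
  shows "\<pi> = \<sigma>"
proof (rule ccontr)
  assume "\<pi> \<noteq> \<sigma>"
  define D where "D = {i. \<pi> i \<noteq> \<sigma> i}"
  define m where "m = Max D"
  have D_sub: "D \<subseteq> {1..n}"
    using \<pi> \<sigma> by (auto simp: D_def permutes_def simp del: atLeastAtMost_iff) metis+
  have "D \<noteq> {}"
    using \<open>\<pi> \<noteq> \<sigma>\<close> by (auto simp: D_def)
  have fin: "finite D"
    using D_sub finite_subset by blast
  have m: "m \<in> D" and max: "\<And>i. i \<in> D \<Longrightarrow> i \<le> m"
    using fin \<open>D \<noteq> {}\<close> by (auto simp: m_def)
  \<comment> \<open>Stated for generic \<open>\<alpha>\<close> and \<open>\<beta>\<close> so that it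
    applies whichever of the two values at \<open>m\<close> is larger.\<close>
  have *: "has_pair (<) (graph_on n \<alpha>) L \<and> has_pair (>) (graph_on n \<beta>) L"
    if \<alpha>: "\<alpha> permutes {1..n}" and \<beta>: "\<beta> permutes {1..n}"
      and less: "\<beta> m < \<alpha> m" and off: "graph_on n \<alpha> - L = graph_on n \<beta> - L"
      and agree: "\<And>i. m < i \<Longrightarrow> \<alpha> i = \<beta> i"
    for \<alpha> \<beta>
  proof -
    have m_in: "m \<in> {1..n}"
      using m D_sub by blast
    have L: "(m, \<alpha> m) \<in> L"
    proof (rule ccontr)
      assume "(m, \<alpha> m) \<notin> L"
      with m_in have "(m, \<alpha> m) \<in> graph_on n \<alpha> - L"
        by simp
      with off less show False
        by auto
    qed
    \<comment> \<open>To the right of \<open>m\<close> the two maps agree, so by injectivity a value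
      that one takes at \<open>m\<close> can be taken by the other only to the left of
      \<open>m\<close>.\<close>
    have pre: "i < m" if "\<gamma> i = \<delta> m" "\<gamma> m \<noteq> \<delta> m" "\<And>i. m < i \<Longrightarrow> \<gamma> i = \<delta> i"
      "inj \<delta>" for \<gamma> \<delta> :: "nat \<Rightarrow> nat" and i
      using that by (metis injD linorder_neqE_nat)
    obtain i where i: "i \<in> {1..n}" "\<alpha> i = \<beta> m"
      using \<alpha> \<beta> m_in by (metis permutes_image permutes_in_image imageE)
    obtain j where j: "j \<in> {1..n}" "\<beta> j = \<alpha> m"
      using \<alpha> \<beta> m_in by (metis permutes_image permutes_in_image imageE)
    have "i < m" "j < m"
      using pre[of \<alpha> i \<beta>] pre[of \<beta> j \<alpha>] i(2) j(2) less agree \<alpha> \<beta>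
      by (auto simp: permutes_inj)
    have "has_pair (<) (graph_on n \<alpha>) L"
      unfolding has_pair_def using i m_in \<open>i < m\<close> less L
      by (intro exI[of _ i] exI[of _ "\<beta> m"] exI[of _ m] exI[of _ "\<alpha> m"]) auto
    moreover have "has_pair (>) (graph_on n \<beta>) L"
      unfolding has_pair_def using j m_in \<open>j < m\<close> less L
      by (intro exI[of _ j] exI[of _ "\<alpha> m"] exI[of _ m] exI[of _ "\<beta> m"]) auto
    ultimately show ?thesis ..
  qed
  have agree: "\<pi> i = \<sigma> i" if "m < i" for i
    using max[of i] that by (auto simp: D_def)
  have "\<pi> m < \<sigma> m \<or> \<sigma> m < \<pi> m"
    using m by (auto simp: D_def)
  then show False
    using *[OF \<pi> \<sigma> _ eq agree] *[OF \<sigma> \<pi> _ eq[symmetric] agree[symmetric]] r av by auto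
qed

text \<open>Exchanging the values of an offending pair changes nothing outside \<open>L\<close> and
  moves a rearrangement sum strictly in one direction. A member of the class that is extremal for
  this sum therefore has no such pair.\<close>

lemma avoider_exists:
  assumes r: "r = (<) \<or> r = (>)"
    and \<pi>: "\<pi> permutes {1..n}"
    and down: "\<And>i j i' j'. (i, j) \<in> L \<Longrightarrow> i' \<le> i \<Longrightarrow> j' \<le> j \<Longrightarrow> (i', j') \<in> L"
  obtains \<sigma> where "\<sigma> permutes {1..n}" "graph_on n \<sigma> - L = graph_on n \<pi> - L"
    "\<not> has_pair r (graph_on n \<sigma>) L"
proof -
  define C where "C = {\<sigma>. \<sigma> permutes {1..n} \<and> graph_on n \<sigma> - L = graph_on n \<pi> - L}"
  \<comment> \<open>Exchanging the values of an ascent lowers the sum of the products of position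
    and value, and doing so for a descent raises it; the sign turns both cases into
    minimisation.\<close>
  define s :: int where "s = (if r = (<) then 1 else -1)"
  define w where "w \<sigma> = s * (\<Sum>i\<in>{1..n}. int i * int (\<sigma> i))" for \<sigma>
  have "finite C" "C \<noteq> {}"
    using \<pi> by (auto simp: C_def intro: finite_subset[OF _ finite_permutations[of "{1..n}"]])
  then obtain \<sigma> where "\<sigma> \<in> C" and min: "\<And>\<rho>. \<rho> \<in> C \<Longrightarrow> w \<sigma> \<le> w \<rho>"
    using arg_min_if_finite[of C w] by (metis linorder_not_le)
  then have \<sigma>: "\<sigma> permutes {1..n}" "graph_on n \<sigma> - L = graph_on n \<pi> - L"
    by (auto simp: C_def)
  moreover have "\<not> has_pair r (graph_on n \<sigma>) L"
  proof
    assume "has_pair r (graph_on n \<sigma>) L"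
    then obtain i j where ij: "i \<in> {1..n}" "j \<in> {1..n}" "i < j" "r (\<sigma> i) (\<sigma> j)"
      and L: "(j, max (\<sigma> i) (\<sigma> j)) \<in> L"
      unfolding has_pair_def by auto
    define \<rho> where "\<rho> = \<sigma> \<circ> transpose i j"
    have \<rho>_simps: "\<rho> i = \<sigma> j" "\<rho> j = \<sigma> i" "\<And>k. k \<noteq> i \<Longrightarrow> k \<noteq> j \<Longrightarrow> \<rho> k = \<sigma> k"
      by (auto simp: \<rho>_def)
    \<comment> \<open>The old and new positions of both points lie weakly south-west of the corner,
      so downward closure places all four cells in \<open>L\<close>.\<close>
    have in_L: "(k, \<sigma> i) \<in> L" "(k, \<sigma> j) \<in> L" if "k \<in> {i, j}" for k
      using that ij(3) by (auto intro!: down[OF L])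
    have "(k, a) \<in> graph_on n \<rho> - L \<longleftrightarrow> (k, a) \<in> graph_on n \<sigma> - L" for k a
    proof (cases "k \<in> {i, j}")
      case True
      then have "(k, \<rho> k) \<in> L" "(k, \<sigma> k) \<in> L"
        using in_L[OF True] \<rho>_simps(1,2) by auto
      then show ?thesis
        by auto
    next
      case False
      then show ?thesis
        using \<rho>_simps(3)[of k] by simp
    qed
    then have "graph_on n \<rho> - L = graph_on n \<sigma> - L"
      by (simp only: set_eq_iff split_paired_All simp_thms)
    moreover have "\<rho> permutes {1..n}"
      unfolding \<rho>_def using ij(1,2) \<sigma>(1) by (intro permutes_compose permutes_swap_id)
    ultimately have "\<rho> \<in> C"
      using \<sigma>(2) by (simp add: C_def)
    have split: "(\<Sum>k\<in>{1..n}. int k * int (\<alpha> k)) = int i * int (\<alpha> i) + int j * int (\<alpha> j)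
        + (\<Sum>k\<in>{1..n} - {i, j}. int k * int (\<alpha> k))" for \<alpha> :: "nat \<Rightarrow> nat"
      using ij(1-3) sum.subset_diff[of "{i, j}" "{1..n}" "\<lambda>k. int k * int (\<alpha> k)"] by simp
    have "(\<Sum>k\<in>{1..n} - {i, j}. int k * int (\<rho> k)) = (\<Sum>k\<in>{1..n} - {i, j}. int k * int (\<sigma> k))"
      by (intro sum.cong) (auto simp: \<rho>_simps)
    then have diff: "w \<rho> - w \<sigma> = - (s * ((int j - int i) * (int (\<sigma> j) - int (\<sigma> i))))"
      unfolding w_def split by (simp add: \<rho>_simps algebra_simps)
    have pos: "0 < s * (int (\<sigma> j) - int (\<sigma> i))"
      using r ij(4) by (auto simp: s_def fun_eq_iff)
    have "0 < (int j - int i) * (s * (int (\<sigma> j) - int (\<sigma> i)))"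
      using ij(3) by (intro mult_pos_pos[OF _ pos]) simp
    then have "w \<rho> < w \<sigma>"
      using diff by (simp add: mult.left_commute)
    with min[OF \<open>\<rho> \<in> C\<close>] show False
      by simp
  qed
  ultimately show ?thesis
    using that by blast
qed

section \<open>Passage to involutions and counting\<close>

lemma graph_on_subset:
  assumes "\<pi> permutes {1..n}"
  shows "graph_on n \<pi> \<subseteq> {..n} \<times> {..n}"
  using permutes_in_image[OF assms] by (fastforce simp: graph_on_def)

text \<open>The inverse of the avoider in the class of \<open>\<pi>\<close> is again an avoider in
  that class, as \<open>L\<close> and the graph of \<open>\<pi>\<close> are symmetric; uniqueness
  makes the two equal. By \<open>region_cong\<close> the new involution has the same region, so it
  avoids pairs relative to its own region.\<close>

lemma involution_avoider_exists:
  assumes r: "r = (<) \<or> r = (>)"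
    and \<pi>: "\<pi> permutes {1..n}" "\<pi> \<circ> \<pi> = id"
  obtains \<sigma> where "\<sigma> permutes {1..n}" "\<sigma> \<circ> \<sigma> = id"
    "region \<tau> (graph_on n \<sigma>) = region \<tau> (graph_on n \<pi>)"
    "graph_on n \<sigma> - region \<tau> (graph_on n \<pi>) = graph_on n \<pi> - region \<tau> (graph_on n \<pi>)"
    "\<not> has_pair r (graph_on n \<sigma>) (region \<tau> (graph_on n \<pi>))"
proof -
  define L where "L = region \<tau> (graph_on n \<pi>)"
  obtain \<sigma> where \<sigma>: "\<sigma> permutes {1..n}" "graph_on n \<sigma> - L = graph_on n \<pi> - L"
    "\<not> has_pair r (graph_on n \<sigma>) L"
    using avoider_exists[OF r \<pi>(1), of L] region_downward unfolding L_def by blast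
  have "inv \<pi> = \<pi>"
    using \<pi>(2) by (simp add: inv_unique_comp)
  then have sym: "(graph_on n \<pi>)\<inverse> = graph_on n \<pi>"
    using graph_on_inv[OF \<pi>(1)] by simp
  then have L_sym: "L\<inverse> = L"
    unfolding L_def by (metis region_converse)
  have conv_Diff: "(A - B)\<inverse> = A\<inverse> - B\<inverse>" for A B :: "(nat \<times> nat) set"
    by blast
  have inv_\<sigma>: "graph_on n (inv \<sigma>) = (graph_on n \<sigma>)\<inverse>"
    using \<sigma>(1) by (rule graph_on_inv)
  have "graph_on n (inv \<sigma>) - L = (graph_on n \<sigma> - L)\<inverse>"
    unfolding inv_\<sigma> by (subst L_sym[symmetric]) (rule conv_Diff[symmetric])
  also have "\<dots> = graph_on n \<sigma> - L"
    unfolding \<sigma>(2) conv_Diff sym L_sym ..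
  finally have "graph_on n (inv \<sigma>) - L = graph_on n \<sigma> - L" .
  moreover have "\<not> has_pair r (graph_on n (inv \<sigma>)) L"
  proof
    assume "has_pair r (graph_on n (inv \<sigma>)) L"
    from has_pair_converse[OF r this] show False
      using \<sigma>(3) by (simp add: inv_\<sigma> L_sym)
  qed
  ultimately have "inv \<sigma> = \<sigma>"
    using avoider_unique[OF r permutes_inv[OF \<sigma>(1)] \<sigma>(1)] \<sigma>(3) by blast
  then have "\<sigma> \<circ> \<sigma> = id"
    using permutes_inv_o(1)[OF \<sigma>(1)] by simp
  moreover have "region \<tau> (graph_on n \<sigma>) = L"
    unfolding L_def using \<sigma>(2) L_def by (intro region_cong[OF graph_on_subset[OF \<pi>(1)]]) simp
  ultimately show ?thesis
    using that \<sigma> unfolding L_def by blast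
qed

text \<open>Each avoider for \<open>r\<close> is related to some avoider for \<open>r'\<close> in
  its class, and no two share one. As \<open>r\<close> and \<open>r'\<close> are arbitrary among
  \<open><\<close> and \<open>>\<close>, using the inequality both ways gives equality.\<close>

lemma card_involution_avoiders_le:
  fixes \<tau> :: "nat list" and n :: nat
  assumes r: "r = (<) \<or> r = (>)" and r': "r' = (<) \<or> r' = (>)"
  defines "A \<equiv> \<lambda>r. {\<pi>. \<pi> permutes {1..n} \<and> \<pi> \<circ> \<pi> = id \<and>
    \<not> has_pair r (graph_on n \<pi>) (region \<tau> (graph_on n \<pi>))}"
  shows "card (A r) \<le> card (A r')"
proof -
  define rel where "rel \<pi> \<sigma> \<longleftrightarrow> region \<tau> (graph_on n \<sigma>) = region \<tau> (graph_on n \<pi>) \<and>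
    graph_on n \<sigma> - region \<tau> (graph_on n \<pi>) = graph_on n \<pi> - region \<tau> (graph_on n \<pi>)" for \<pi> \<sigma>
  have "finite (A r')"
    unfolding A_def by (rule finite_subset[OF _ finite_permutations[of "{1..n}"]]) auto
  moreover have "\<exists>\<sigma>. \<sigma> \<in> A r' \<and> rel \<pi> \<sigma>" if "\<pi> \<in> A r" for \<pi>
  proof -
    from that have "\<pi> permutes {1..n}" "\<pi> \<circ> \<pi> = id"
      by (auto simp: A_def)
    then obtain \<sigma> where "\<sigma> permutes {1..n}" "\<sigma> \<circ> \<sigma> = id" "rel \<pi> \<sigma>"
      "\<not> has_pair r' (graph_on n \<sigma>) (region \<tau> (graph_on n \<pi>))"
      unfolding rel_def by (rule involution_avoider_exists[OF r']) blast
    then show ?thesis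
      unfolding A_def rel_def by auto
  qed
  moreover have "\<pi> = \<rho>" if "\<pi> \<in> A r" "\<rho> \<in> A r" "rel \<pi> \<sigma>" "rel \<rho> \<sigma>" for \<pi> \<rho> \<sigma>
  proof (rule avoider_unique[OF r])
    have "region \<tau> (graph_on n \<rho>) = region \<tau> (graph_on n \<pi>)"
      using that(3,4) unfolding rel_def by metis
    then show "\<not> has_pair r (graph_on n \<rho>) (region \<tau> (graph_on n \<pi>))"
      "graph_on n \<pi> - region \<tau> (graph_on n \<pi>) = graph_on n \<rho> - region \<tau> (graph_on n \<pi>)"
      using that(2-4) unfolding A_def rel_def by auto
  qed (use that(1,2) in \<open>auto simp: A_def\<close>)
  ultimately show ?thesis
    by (rule card_le_if_inj_on_rel)
qed

text \<open>Containment concerns \<open>dominated\<close>, the class argument concerns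
  \<open>region\<close>; the graph of an involution is symmetric, which makes the two
  interchangeable here.\<close>

lemma inv_count_prefix:
  assumes xy: "(x, y) = (1, 2) \<and> r = (<) \<or> (x, y) = (2, 1) \<and> r = (>)"
    and \<tau>: "\<forall>t\<in>set \<tau>. 2 < t"
  shows "inv_count n ([x, y] @ \<tau>) = card {\<pi>. \<pi> permutes {1..n} \<and> \<pi> \<circ> \<pi> = id \<and>
    \<not> has_pair r (graph_on n \<pi>) (region \<tau> (graph_on n \<pi>))}"
proof -
  have r: "r = (<) \<or> r = (>)"
    using xy by blast
  have "avoids n \<pi> ([x, y] @ \<tau>) \<longleftrightarrow> \<not> has_pair r (graph_on n \<pi>) (region \<tau> (graph_on n \<pi>))"
    if \<pi>: "\<pi> permutes {1..n}" "\<pi> \<circ> \<pi> = id" for \<pi>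
  proof -
    have "inv \<pi> = \<pi>"
      using \<pi>(2) by (simp add: inv_unique_comp)
    then have "(graph_on n \<pi>)\<inverse> = graph_on n \<pi>"
      using graph_on_inv[OF \<pi>(1)] by simp
    then show ?thesis
      unfolding avoids_def word_contains_iff_occurrence
        occurrence_prefix_iff_has_pair[OF xy \<tau>]
      using has_pair_region_iff_dominated[OF r] by blast
  qed
  then show ?thesis
    unfolding inv_count_def by (metis (no_types, lifting))
qed

theorem corollary4p3:
  shows "prefixes_exchangeable 2 [1, 2] [2, 1]"
proof -
  have "[1, 2] @ \<tau> \<sim>\<^sub>I [2, 1] @ \<tau>" if "\<tau> \<in> permutations_of_set {2 + 1..k}" for k \<tau>
  proof -
    have \<tau>: "\<forall>t\<in>set \<tau>. 2 < t"
      using permutations_of_setD(1)[OF that] by auto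
    have "inv_count n ([1, 2] @ \<tau>) = inv_count n ([2, 1] @ \<tau>)" for n
    proof -
      \<comment> \<open>The two instances of \<open>inv_count_prefix\<close> fix \<open>r\<close> as
        \<open><\<close> for \<open>12\<close> and as \<open>>\<close> for
        \<open>21\<close>.\<close>
      have "inv_count n ([1, 2] @ \<tau>) \<le> inv_count n ([2, 1] @ \<tau>)"
        unfolding inv_count_prefix[OF disjI1[OF conjI[OF refl refl]] \<tau>]
          inv_count_prefix[OF disjI2[OF conjI[OF refl refl]] \<tau>]
        by (rule card_involution_avoiders_le) simp_all
      moreover have "inv_count n ([2, 1] @ \<tau>) \<le> inv_count n ([1, 2] @ \<tau>)"
        unfolding inv_count_prefix[OF disjI1[OF conjI[OF refl refl]] \<tau>]
          inv_count_prefix[OF disjI2[OF conjI[OF refl refl]] \<tau>]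
        by (rule card_involution_avoiders_le) simp_all
      ultimately show ?thesis
        by (rule antisym)
    qed
    then show ?thesis
      unfolding inv_equiv_def by blast
  qed
  moreover have "{1..2} = {1, 2 :: nat}"
    by auto
  ultimately show ?thesis
    unfolding prefixes_exchangeable_def by (auto simp: permutations_of_set_def)
qed

end
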